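(* For all $d\in\mathbb{N}$ and all $\varepsilon\in(0,1)$, \[ N^{\mathrm{cap}}(\varepsilon,d) \le \left\lceil \frac{1}{\varepsilon^2}\,\frac{1}{\sqrt{\pi d}-1}\right\rceil. \]
   Context: $\mathbb{S}^d=\{\bm{x}\in\mathbb{R}^{d+1}:\|\bm{x}\|_2=1\}$ with the surface measure $\sigma_d$ normalized so that $\sigma_d(\mathbb{S}^d)=1$. For $\bm{x}\in\mathbb{S}^d$ and $t\in[-1,1]$, $C(\bm{x};t)=\{\bm{y}\in\mathbb{S}^d:\langle\bm{x},\bm{y}\rangle\ge t\}$ is a spherical cap, with indicator function $\bm{1}_{C(\bm{x};t)}$. For an $N$-point set $P_{N,d}=\{\bm{x}_1,\dots,\bm{x}_N\}\subseteq\mathbb{S}^d$, the spherical cap $L_2$ discrepancy is \[ L_2^{\mathrm{cap}}(P_{N,d}) = \left(\int_{-1}^1\int_{\mathbb{S}^d}\Big(\frac1N\sum_{n=1}^N \bm{1}_{C(\bm{x};t)}(\bm{x}_n)-\sigma_d(C(\bm{x};t))\Big)^2\mathrm{d}\sigma_d(\bm{x})\,\mathrm{d}t\right)^{1/2}, \] and the initial discrepancy is $L_2^{\mathrm{cap}}(\emptyset)=\left(\int_{-1}^1\int_{\mathbb{S}^d}\sigma_d(C(\bm{x};t))^2\,\mathrm{d}\sigma_d(\bm{x})\,\mathrm{d}t\right)^{1/2}$. For $\varepsilon\in(0,1)$ the inverse discrepancy is $N^{\mathrm{cap}}(\varepsilon,d)=\inf\{N\in\mathbb{N}:\exists P_{N,d}\subseteq\mathbb{S}^d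 \text{ with } L_2^{\mathrm{cap}}(P_{N,d})\le\varepsilon L_2^{\mathrm{cap}}(\emptyset)\}$. *)

theory Defs
  imports "HOL-Analysis.Analysis" "HOL-Library.Extended_Nat"
begin

text \<open>Normalized surface measure on the unit sphere of a Euclidean space:
  the push-forward of the uniform probability measure on the open unit ball under
  the radial projection x \<mapsto> x / norm x (sgn). It is a probability measure
  concentrated on sphere 0 1 and coincides with the rotation-invariant surface
  measure normalized to total mass 1.\<close>
definition sphere_meas :: "'a::euclidean_space measure" where
  "sphere_meas = distr (uniform_measure lborel (ball 0 1)) borel sgn"

definition cap :: "'a::euclidean_space \<Rightarrow> real \<Rightarrow> 'a set" where
  "cap x t = {y \<in> sphere 0 1. inner x y \<ge> t}"

definition L2cap :: "(nat \<Rightarrow> 'a::euclidean_space) \<Rightarrow> nat \<Rightarrow> real" where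
  "L2cap X N = sqrt (LBINT t=-1..1.
      (\<integral>x. ((1 / real N) * (\<Sum>n<N. indicator (cap x t) (X n))
              - measure sphere_meas (cap x t))\<^sup>2 \<partial>sphere_meas))"

definition L2cap_empty :: "'a::euclidean_space itself \<Rightarrow> real" where
  "L2cap_empty _ = sqrt (LBINT t=-1..1.
      (\<integral>x. (measure (sphere_meas :: 'a measure) (cap x t))\<^sup>2 \<partial>(sphere_meas :: 'a measure)))"

text \<open>Inverse discrepancy (infimum over the empty set is \<infinity>).\<close>
definition N_cap :: "'a::euclidean_space itself \<Rightarrow> real \<Rightarrow> enat" where
  "N_cap T \<epsilon> = (INF N \<in> {N::nat. N \<ge> 1 \<and> (\<exists>X :: nat \<Rightarrow> 'a.
        (\<forall>n<N. X n \<in> sphere 0 1) \<and> L2cap X N \<le> \<epsilon> * L2cap_empty T)}. enat N)"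

end

theory Submission
  imports Defs "HOL-Probability.Probability_Measure"
begin

text \<open>
  Let \<open>V = \<integral>\<integral> \<sigma>(C) (1 - \<sigma>(C))\<close>, integrated over all centres and heights of caps \<open>C\<close>. Adding a
  point to a given configuration increases the unnormalised squared discrepancy by \<open>V\<close> on
  average, so points chosen greedily have squared discrepancy at most \<open>V / N\<close>. Since
  \<open>\<sigma>(C)\<close> has integral 1 (a random inner product has mean 0), the squared initial discrepancy is
  \<open>1 - V\<close>, and it remains to see that \<open>V \<le> 1 / sqrt (pi * d)\<close>.

  As \<open>V\<close> is half the mean measure of the set of caps that separate two independent uniform
  points \<open>y, y'\<close>, it is half the mean of \<open>\<bar>x \<bullet> (y - y')\<bar>\<close>. By
  rotation invariance this mean is the product of the mean of \<open>norm (y - y')\<close>, at most \<open>sqrt 2\<close>,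
  and the mean of \<open>\<bar>x \<bullet> e\<bar>\<close>, a quotient of Gamma values that log-convexity bounds by
  \<open>sqrt (2 / (pi * d))\<close>.
\<close>

section \<open>Greedy choice of points\<close>

lemma integral_swap_bounded:
  fixes f :: "'a \<Rightarrow> 'b \<Rightarrow> real"
  assumes "finite_measure M" "finite_measure S"
    and f: "(\<lambda>(p, y). f p y) \<in> borel_measurable (M \<Otimes>\<^sub>M S)"
    and bound: "\<And>p y. \<bar>f p y\<bar> \<le> B"
  shows "(\<integral>p. (\<integral>y. f p y \<partial>S) \<partial>M) = (\<integral>y. (\<integral>p. f p y \<partial>M) \<partial>S)"
proof -
  interpret M: finite_measure M by fact
  interpret S: finite_measure S by fact
  interpret pair_sigma_finite M S ..
  interpret P: finite_measure "M \<Otimes>\<^sub>M S"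
    by (rule finite_measure_pair_measure) fact+
  have "integrable (M \<Otimes>\<^sub>M S) (\<lambda>(p, y). f p y)"
    by (rule P.integrable_const_bound[where B=B]) (use f bound in auto)
  from Fubini_integral[OF this] show ?thesis by simp
qed

text \<open>First-moment argument: if \<open>G\<close> exceeded its mean at every point of
  \<open>A\<close>, it would do so almost everywhere, and so would its integral. The set
  \<open>A\<close> of full measure is carried along because \<open>sphere_meas\<close> lives on the
  whole space, while the chosen points must lie on the sphere.\<close>

lemma (in prob_space) ex_le_expectation:
  fixes G :: "'a \<Rightarrow> real"
  assumes G: "integrable M G" and A: "AE y in M. y \<in> A"
  shows "\<exists>y\<in>A \<inter> space M. G y \<le> expectation G"
proof (rule ccontr)
  assume neg: "\<not> ?thesis"
  have *: "AE y in M. expectation G < G y"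
    using A AE_space by eventually_elim (use neg in force)
  have "(\<integral>y. expectation G \<partial>M) < (\<integral>y. G y \<partial>M)"
    by (rule integral_less_AE_space) (use G * emeasure_space_1 in simp_all)
  then show False
    by (simp add: prob_space)
qed

text \<open>Each step picks a point at which the increment is at most its mean; the cross term of the
  square averages to 0.\<close>
lemma greedy_points:
  fixes h :: "'p \<Rightarrow> 'b \<Rightarrow> real"
  assumes M: "finite_measure M" and S: "prob_space S"
    and h [measurable]: "(\<lambda>(p, y). h p y) \<in> borel_measurable (M \<Otimes>\<^sub>M S)"
    and h01: "\<And>p y. 0 \<le> h p y" "\<And>p y. h p y \<le> 1"
    and A: "AE y in S. y \<in> A"
  defines "s \<equiv> \<lambda>p. \<integral>y. h p y \<partial>S"
  shows "\<exists>X. (\<forall>n<N. X n \<in> A) \<and>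
    (\<integral>p. (\<Sum>n<N. h p (X n) - s p)\<^sup>2 \<partial>M) \<le> real N * (\<integral>p. (\<integral>y. (h p y - s p)\<^sup>2 \<partial>S) \<partial>M)"
proof -
  interpret M: finite_measure M by fact
  interpret S: prob_space S by fact
  have s [measurable]: "s \<in> borel_measurable M"
    unfolding s_def by measurable
  have hm [measurable]: "h p \<in> borel_measurable S" if "p \<in> space M" for p
    using measurable_Pair2[OF h that] by simp
  have hi: "integrable S (h p)" if "p \<in> space M" for p
    by (rule S.integrable_const_bound[where B=1]) (use h01 hm[OF that] in auto)
  have s0: "0 \<le> s p" for p
    unfolding s_def by (rule Bochner_Integration.integral_nonneg) (rule h01)
  \<comment> \<open>For \<open>p\<close> outside \<open>space M\<close> the section
    \<open>h p\<close> may fail to be integrable; its integral is then 0 by default, so the bound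
    holds for every \<open>p\<close>.\<close>
  have s1: "s p \<le> 1" for p
  proof (cases "integrable S (h p)")
    case True
    have "s p \<le> (\<integral>y. 1 \<partial>S)"
      unfolding s_def by (rule integral_mono) (use True h01 in auto)
    then show ?thesis by (simp add: S.prob_space)
  qed (simp add: s_def not_integrable_integral_eq)
  have hs: "\<bar>h p y - s p\<bar> \<le> 1" for p y
    using h01[of p y] s0[of p] s1[of p] by linarith
  \<comment> \<open>The induction also keeps the points in \<open>space S\<close>, since only there
    are the sections \<open>\<lambda>p. h p (X n)\<close> known to be measurable.\<close>
  have "\<exists>X. (\<forall>n<N. X n \<in> A \<inter> space S) \<and>
    (\<integral>p. (\<Sum>n<N. h p (X n) - s p)\<^sup>2 \<partial>M) \<le> real N * (\<integral>p. (\<integral>y. (h p y - s p)\<^sup>2 \<partial>S) \<partial>M)"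
  proof (induction N)
    case 0
    show ?case by simp
  next
    case (Suc N)
    then obtain X where X: "\<And>n. n < N \<Longrightarrow> X n \<in> A \<inter> space S"
      and IH: "(\<integral>p. (\<Sum>n<N. h p (X n) - s p)\<^sup>2 \<partial>M) \<le> real N * (\<integral>p. (\<integral>y. (h p y - s p)\<^sup>2 \<partial>S) \<partial>M)"
      by blast
    define R where "R p = (\<Sum>n<N. h p (X n) - s p)" for p
    have [measurable]: "(\<lambda>p. h p (X n)) \<in> borel_measurable M" if "n < N" for n
      using measurable_Pair1[OF h, of "X n"] X[OF that] by simp
    have R [measurable]: "R \<in> borel_measurable M"
      unfolding R_def by (intro borel_measurable_sum borel_measurable_diff s) auto
    have Rb: "\<bar>R p\<bar> \<le> real N" for p
      unfolding R_def using sum_norm_le[of "{..<N}" "\<lambda>n. h p (X n) - s p" "\<lambda>n. 1"] hs by simp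
    have sqb: "(R p + (h p y - s p))\<^sup>2 \<le> (real N + 1)\<^sup>2" for p y
      using abs_le_square_iff[of "R p + (h p y - s p)" "real N + 1"] Rb[of p] hs[of p y] by linarith
    have sqm [measurable]: "(\<lambda>(p, y). (R p + (h p y - s p))\<^sup>2) \<in> borel_measurable (M \<Otimes>\<^sub>M S)"
      by measurable
    \<comment> \<open>\<open>G y\<close> is the value of the squared sum once \<open>y\<close> is
      appended. Its mean over \<open>y\<close> is the old value plus the mean variance, so a point
      with \<open>G y\<close> at most the mean completes the induction step.\<close>
    define G where "G y = (\<integral>p. (R p + (h p y - s p))\<^sup>2 \<partial>M)" for y
    have Gm: "G \<in> borel_measurable S"
      unfolding G_def using sqm by measurable
    have G: "integrable S G"
    proof (rule S.integrable_const_bound[where B = "(real N + 1)\<^sup>2 * measure M (space M)"])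
      have "G y \<le> (real N + 1)\<^sup>2 * measure M (space M)" if "y \<in> space S" for y
      proof -
        have "(\<lambda>p. h p y) \<in> borel_measurable M"
          using measurable_Pair1[OF h that] by simp
        then have "integrable M (\<lambda>p. (R p + (h p y - s p))\<^sup>2)"
          by (intro M.integrable_const_bound[where B="(real N + 1)\<^sup>2"]) (use sqb in auto)
        then have "G y \<le> (\<integral>p. (real N + 1)\<^sup>2 \<partial>M)"
          unfolding G_def by (rule integral_mono) (use sqb in auto)
        then show ?thesis by (simp add: mult.commute)
      qed
      moreover have "0 \<le> G y" for y
        unfolding G_def by simp
      ultimately show "AE y in S. norm (G y) \<le> (real N + 1)\<^sup>2 * measure M (space M)"
        by auto
    qed (rule Gm)
    from S.ex_le_expectation[OF G A] obtain y where y: "y \<in> A \<inter> space S" "G y \<le> S.expectation G"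
      by blast
    have "S.expectation G = (\<integral>p. (\<integral>y. (R p + (h p y - s p))\<^sup>2 \<partial>S) \<partial>M)"
      unfolding G_def
      by (rule integral_swap_bounded[symmetric, where B="(real N + 1)\<^sup>2"]) (use M S.finite_measure_axioms sqm sqb in auto)
    also have "\<dots> = (\<integral>p. (R p)\<^sup>2 + (\<integral>y. (h p y - s p)\<^sup>2 \<partial>S) \<partial>M)"
    proof (rule Bochner_Integration.integral_cong[OF refl])
      fix p assume p: "p \<in> space M"
      have i1: "integrable S (\<lambda>y. h p y - s p)"
        using hi[OF p] by simp
      have i2: "integrable S (\<lambda>y. (h p y - s p)\<^sup>2)"
        by (rule S.integrable_const_bound[where B=1])
          (use hs hm[OF p] in \<open>auto simp: abs_square_le_1\<close>)
      have "(\<integral>y. h p y - s p \<partial>S) = 0"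
        using hi[OF p] by (simp add: s_def S.prob_space)
      then show "(\<integral>y. (R p + (h p y - s p))\<^sup>2 \<partial>S) = (R p)\<^sup>2 + (\<integral>y. (h p y - s p)\<^sup>2 \<partial>S)"
        unfolding power2_sum using i1 i2 by (simp add: S.prob_space del: Bochner_Integration.integral_diff)
    qed
    also have "\<dots> = (\<integral>p. (R p)\<^sup>2 \<partial>M) + (\<integral>p. (\<integral>y. (h p y - s p)\<^sup>2 \<partial>S) \<partial>M)"
    proof (rule Bochner_Integration.integral_add)
      show "integrable M (\<lambda>p. (R p)\<^sup>2)"
        by (rule M.integrable_const_bound[where B="(real N)\<^sup>2"])
          (use Rb in \<open>auto simp: abs_le_square_iff[symmetric]\<close>)
      have "\<bar>\<integral>y. (h p y - s p)\<^sup>2 \<partial>S\<bar> \<le> 1" if "p \<in> space M" for p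
      proof -
        have i2: "integrable S (\<lambda>y. (h p y - s p)\<^sup>2)"
          by (rule S.integrable_const_bound[where B=1])
            (use hs hm[OF that] in \<open>auto simp: abs_square_le_1\<close>)
        have "(\<integral>y. (h p y - s p)\<^sup>2 \<partial>S) \<le> (\<integral>y. 1 \<partial>S)"
          by (rule integral_mono[OF i2]) (use hs in \<open>auto simp: abs_square_le_1\<close>)
        then show ?thesis by (simp add: S.prob_space)
      qed
      then show "integrable M (\<lambda>p. \<integral>y. (h p y - s p)\<^sup>2 \<partial>S)"
        by (intro M.integrable_const_bound[where B=1]) auto
    qed
    finally have "G y \<le> real (Suc N) * (\<integral>p. (\<integral>y. (h p y - s p)\<^sup>2 \<partial>S) \<partial>M)"
      using y(2) IH by (simp add: R_def algebra_simps)
    moreover have "(\<Sum>n<Suc N. h p ((X(N := y)) n) - s p) = R p + (h p y - s p)" for p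
      by (simp add: R_def)
    ultimately show ?case
      using X y(1) unfolding G_def
      by (intro exI[of _ "X(N := y)"]) (auto simp: less_Suc_eq)
  qed
  then show ?thesis by blast
qed

section \<open>Radial and rotational symmetry of Lebesgue measure\<close>

lemma measurable_mem_ball_0 [measurable (raw)]:
  fixes f :: "'b \<Rightarrow> 'a::euclidean_space"
  assumes [measurable]: "f \<in> borel_measurable M" "r \<in> borel_measurable M"
  shows "Measurable.pred M (\<lambda>x. f x \<in> ball 0 (r x))" "Measurable.pred M (\<lambda>x. f x \<in> cball 0 (r x))"
  by (simp_all add: mem_ball mem_cball)


text \<open>Uniqueness of translation invariant measures: evaluating the integral of
  \<open>indicator A x * indicator B (y - x)\<close> in both orders.\<close>
lemma lborel_distr_isometry:
  fixes T :: "'a::euclidean_space \<Rightarrow> 'a"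
  assumes T: "orthogonal_transformation T"
  shows "distr lborel borel T = lborel"
proof (rule measure_eqI)
  have lin: "linear T" and nrm: "norm (T x) = norm x" for x
    using T by (auto simp: orthogonal_transformation)
  have [measurable]: "T \<in> borel_measurable borel"
    using lin by (intro borel_measurable_continuous_onI linear_continuous_on) (simp add: linear_conv_bounded_linear)
  let ?L = "lborel :: 'a measure"
  let ?B = "ball 0 1 :: 'a set"
  fix A :: "'a set"
  assume "A \<in> sets (distr lborel borel T)"
  then have A [measurable]: "A \<in> sets borel" by simp
  obtain S where S: "\<And>x. T (S x) = x"
    using orthogonal_transformation_surj[OF T] by (metis surjD)
  define v where "v C = (\<integral>\<^sup>+y. indicator C (T y) \<partial>?L)" for C :: "'a set"
  have v: "v C = emeasure (distr lborel borel T) C" if "C \<in> sets borel" for C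
  proof -
    have "emeasure (distr lborel borel T) C = (\<integral>\<^sup>+y. indicator C y \<partial>distr lborel borel T)"
      using that by simp
    also have "\<dots> = v C"
      unfolding v_def using that by (subst nn_integral_distr) auto
    finally show ?thesis by simp
  qed
  have trans: "(\<integral>\<^sup>+y. f (y + c) \<partial>?L) = (\<integral>\<^sup>+y. f y \<partial>?L)" if [measurable]: "f \<in> borel_measurable borel"
    for f :: "'a \<Rightarrow> ennreal" and c
  proof -
    have "(\<integral>\<^sup>+y. f y \<partial>?L) = (\<integral>\<^sup>+y. f y \<partial>distr lborel borel ((+) c))"
      by (simp add: lborel_distr_plus)
    also have "\<dots> = (\<integral>\<^sup>+y. f (y + c) \<partial>?L)"
      by (subst nn_integral_distr) (auto simp: add.commute)
    finally show ?thesis by simp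
  qed
  have neg: "(\<integral>\<^sup>+y. f (- y) \<partial>?L) = (\<integral>\<^sup>+y. f y \<partial>?L)" if [measurable]: "f \<in> borel_measurable borel"
    for f :: "'a \<Rightarrow> ennreal"
  proof -
    have "(\<integral>\<^sup>+y. f y \<partial>?L) = (\<integral>\<^sup>+y. f y \<partial>density (distr lborel borel uminus) (\<lambda>_. 1))"
      using lborel_affine[of "-1" "0::'a"] by (simp add: one_ennreal_def[symmetric])
    also have "\<dots> = (\<integral>\<^sup>+y. f (- y) \<partial>?L)"
      by (simp add: density_1 nn_integral_distr)
    finally show ?thesis by simp
  qed
  \<comment> \<open>The push-forward inherits translation invariance: subtracting \<open>c\<close>
    after \<open>T\<close> amounts to subtracting a preimage of \<open>c\<close> before it.\<close>
  have vtrans: "(\<integral>\<^sup>+y. indicator C (T y - c) \<partial>?L) = v C" if [measurable]: "C \<in> sets borel" for C c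
  proof -
    have "T y - c = T (y + - S c)" for y
      using S by (simp add: linear_diff[OF lin])
    then show ?thesis
      unfolding v_def using trans[of "\<lambda>y. indicator C (T y)" "- S c"] by simp
  qed
  \<comment> \<open>\<open>T\<close> preserves norms, so both measures agree on the unit ball. This
    fixes the scaling factor that translation invariance leaves open.\<close>
  have ball: "v ?B = emeasure ?L ?B"
  proof -
    have "v ?B = (\<integral>\<^sup>+y. indicator ?B y \<partial>?L)"
      unfolding v_def by (rule nn_integral_cong) (simp add: indicator_def nrm)
    then show ?thesis by simp
  qed
  have "emeasure ?L A * v ?B = (\<integral>\<^sup>+x. indicator A x * v ?B \<partial>?L)"
    by (simp add: nn_integral_multc)
  also have "\<dots> = (\<integral>\<^sup>+x. (\<integral>\<^sup>+y. indicator A x * indicator ?B (T y - x) \<partial>?L) \<partial>?L)"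
    by (rule nn_integral_cong, subst nn_integral_cmult, measurable) (simp only: vtrans[OF open_ball[THEN borel_open]])
  also have "\<dots> = (\<integral>\<^sup>+y. (\<integral>\<^sup>+x. indicator A x * indicator ?B (T y - x) \<partial>?L) \<partial>?L)"
    by (rule lborel_pair.Fubini') measurable
  also have "\<dots> = (\<integral>\<^sup>+y. (\<integral>\<^sup>+z. indicator A (T y - z) * indicator ?B z \<partial>?L) \<partial>?L)"
  proof (rule nn_integral_cong)
    \<comment> \<open>The substitution \<open>x = T y - z\<close>, carried out as a reflection
      followed by a translation.\<close>
    fix y
    have "(\<integral>\<^sup>+x. indicator A x * indicator ?B (T y - x) \<partial>?L)
        = (\<integral>\<^sup>+x. indicator A (- x) * indicator ?B (T y + x) \<partial>?L)"
      using neg[of "\<lambda>x. indicator A x * indicator ?B (T y - x)"] by simp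
    also have "\<dots> = (\<integral>\<^sup>+z. indicator A (T y - z) * indicator ?B z \<partial>?L)"
      using trans[of "\<lambda>x. indicator A (- x) * indicator ?B (T y + x)" "- T y"] by simp
    finally show "(\<integral>\<^sup>+x. indicator A x * indicator ?B (T y - x) \<partial>?L) = \<dots>" .
  qed
  also have "\<dots> = (\<integral>\<^sup>+z. (\<integral>\<^sup>+y. indicator A (T y - z) * indicator ?B z \<partial>?L) \<partial>?L)"
    by (rule lborel_pair.Fubini') measurable
  also have "\<dots> = (\<integral>\<^sup>+z. v A * indicator ?B z \<partial>?L)"
    by (rule nn_integral_cong, subst nn_integral_multc, measurable) (simp only: vtrans[OF A])
  also have "\<dots> = v A * emeasure ?L ?B"
    by (simp add: nn_integral_cmult)
  finally have "emeasure ?L A * emeasure ?L ?B = v A * emeasure ?L ?B"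
    by (simp add: ball)
  moreover have "emeasure ?L ?B \<noteq> 0" "emeasure ?L ?B \<noteq> \<infinity>"
    by (simp_all add: emeasure_ball less_imp_neq[OF unit_ball_vol_pos, symmetric])
  ultimately show "emeasure (distr lborel borel T) A = emeasure lborel A"
    using v[of A] by (simp add: mult.commute[of _ "emeasure ?L ?B"] ennreal_mult_cancel_left)
qed simp

text \<open>If \<open>a\<close> and \<open>b\<close> differ, the reflection in the hyperplane
  orthogonal to \<open>w = a - b\<close> works: equal norms give
  \<open>2 * (a \<bullet> w) = w \<bullet> w\<close>, hence \<open>T a = a - w = b\<close>.\<close>

lemma ex_orthogonal_transformation:
  fixes a b :: "'a::euclidean_space"
  assumes "norm a = norm b"
  shows "\<exists>T. orthogonal_transformation T \<and> T a = b"
proof (cases "a = b")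
  case True
  then show ?thesis by (intro exI[of _ id]) (simp add: orthogonal_transformation_id id_def)
next
  case False
  define w where "w = a - b"
  define T where "T x = x - (2 * (x \<bullet> w) / (w \<bullet> w)) *\<^sub>R w" for x
  have w: "w \<bullet> w \<noteq> 0" using False by (simp add: w_def)
  have lin: "linear T"
    by (rule linearI) (simp_all add: T_def inner_add_left algebra_simps add_divide_distrib)
  have "T x \<bullet> T y = x \<bullet> y" for x y
    using w by (simp add: T_def inner_diff_left inner_diff_right inner_commute field_simps)
  then have "orthogonal_transformation T"
    using lin by (simp add: orthogonal_transformation_def)
  moreover have "2 * (a \<bullet> w) = w \<bullet> w"
    using assms by (simp add: w_def inner_diff_left inner_diff_right inner_commute norm_eq)
  then have "T a = b"
    using w by (simp add: T_def) (simp add: w_def)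
  ultimately show ?thesis by blast
qed

text \<open>An orthogonal map taking \<open>norm v *\<^sub>R e\<close> to \<open>v\<close> preserves
  Lebesgue measure, the ball and inner products, so only the length of \<open>v\<close>
  matters.\<close>

lemma nn_integral_ball_abs_inner:
  fixes v e :: "'a::euclidean_space"
  assumes "norm e = 1"
  shows "(\<integral>\<^sup>+x. ennreal \<bar>x \<bullet> v\<bar> * indicator (ball 0 1) x \<partial>lborel)
    = ennreal (norm v) * (\<integral>\<^sup>+x. ennreal \<bar>x \<bullet> e\<bar> * indicator (ball 0 1) x \<partial>lborel)"
proof -
  obtain T where T: "orthogonal_transformation T" "T (norm v *\<^sub>R e) = v"
    using ex_orthogonal_transformation[of "norm v *\<^sub>R e" v] assms by auto
  have lin: "linear T" and nrm: "\<And>x. norm (T x) = norm x" and inn: "\<And>x y. T x \<bullet> T y = x \<bullet> y"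
    using T(1) by (auto simp: orthogonal_transformation_def orthogonal_transformation_norm[OF T(1)])
  have [measurable]: "T \<in> borel_measurable borel"
    using lin by (intro borel_measurable_continuous_onI linear_continuous_on) (simp add: linear_conv_bounded_linear)
  have "(\<integral>\<^sup>+x. ennreal \<bar>x \<bullet> v\<bar> * indicator (ball 0 1) x \<partial>lborel)
      = (\<integral>\<^sup>+x. ennreal \<bar>x \<bullet> v\<bar> * indicator (ball 0 1) x \<partial>distr lborel borel T)"
    by (simp add: lborel_distr_isometry[OF T(1)])
  also have "\<dots> = (\<integral>\<^sup>+x. ennreal \<bar>T x \<bullet> v\<bar> * indicator (ball 0 1) (T x) \<partial>lborel)"
    by (rule nn_integral_distr) measurable
  also have "\<dots> = (\<integral>\<^sup>+x. ennreal (norm v) * (ennreal \<bar>x \<bullet> e\<bar> * indicator (ball 0 1) x) \<partial>lborel)"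
  proof (rule nn_integral_cong)
    fix x
    have "T x \<bullet> v = norm v * (x \<bullet> e)"
      using inn[of x "norm v *\<^sub>R e"] T(2) by simp
    then show "ennreal \<bar>T x \<bullet> v\<bar> * indicator (ball 0 1) (T x)
      = ennreal (norm v) * (ennreal \<bar>x \<bullet> e\<bar> * indicator (ball 0 1) x)"
      by (simp add: indicator_def nrm abs_mult ennreal_mult)
  qed
  finally show ?thesis by (simp add: nn_integral_cmult)
qed

text \<open>The integrand is even, and on \<open>{0..1}\<close> the factor \<open>x\<close> is half
  the derivative of \<open>x\<^sup>2\<close>. Substituting \<open>t = x\<^sup>2\<close> therefore
  turns the whole integral into \<open>Beta 1 (n / 2 + 1)\<close>.\<close>

lemma nn_integral_abs_sqrt_power:
  "(\<integral>\<^sup>+x. ennreal (indicator {-1..1} x * (\<bar>x\<bar> * sqrt (1 - x\<^sup>2) ^ n)) \<partial>lborel) = ennreal (2 / (real n + 2))"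
proof -
  have B: "Beta 1 (real n / 2 + 1) = 2 / (real n + 2)"
  proof -
    have "real n / 2 + 1 \<notin> \<int>\<^sub>\<le>\<^sub>0"
      using nonpos_Ints_nonpos[of "real n / 2 + 1"] by auto
    from Gamma_plus1[OF this] have "Gamma (1 + (real n / 2 + 1)) = (real n / 2 + 1) * Gamma (real n / 2 + 1)"
      by (simp only: add.commute[of 1])
    then show ?thesis
      using Gamma_real_pos[of "real n / 2 + 1"]
      by (simp add: Beta_def less_imp_neq[THEN not_sym]) (simp add: field_simps)
  qed
  let ?f = "\<lambda>x::real. ennreal (x * (1 - x\<^sup>2) powr (real n / 2) * indicator {0..1} x)"
  have "((\<lambda>t. t powr 0 * (1 - t) powr (real n / 2)) has_integral Beta 1 (real n / 2 + 1)) {0..1}"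
    using has_integral_Beta_real[of 1 "n / 2 + 1"] by simp
  from nn_integral_has_integral_lebesgue[OF _ this] have
     "ennreal (Beta 1 (real n / 2 + 1)) =
        nn_integral lborel (\<lambda>t. ennreal (t powr 0 * (1 - t) powr (real n / 2) *
                                indicator {0^2..1^2} t))"
    by (simp add: mult_ac ennreal_mult' ennreal_indicator)
  also have "\<dots> = (\<integral>\<^sup>+ x. ennreal (x\<^sup>2 powr 0 * (1 - x\<^sup>2) powr (real n / 2) * (2 * x) *
                          indicator {0..1} x) \<partial>lborel)"
    by (subst nn_integral_substitution[where g = "\<lambda>x. x ^ 2" and g' = "\<lambda>x. 2 * x"])
       (auto intro!: derivative_eq_intros continuous_intros simp: set_borel_measurable_def)
  \<comment> \<open>The factor 2 of the derivative is split into two copies of \<open>?f\<close>;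
    the second is then reflected to cover the negative half of the interval.\<close>
  also have "\<dots> = (\<integral>\<^sup>+ x. ?f x + ?f x \<partial>lborel)"
    by (intro nn_integral_cong) (auto simp: indicator_def ennreal_plus[symmetric] simp del: ennreal_plus)
  also have "\<dots> = (\<integral>\<^sup>+ x. ?f x \<partial>lborel) + (\<integral>\<^sup>+ x. ?f x \<partial>lborel)"
    by (subst nn_integral_add) auto
  also have "\<dots> = (\<integral>\<^sup>+ x. ?f x \<partial>lborel) + (\<integral>\<^sup>+ x. ?f (- x) \<partial>lborel)"
    by (subst (2) nn_integral_real_affine[of _ "-1" 0]) auto
  also have "\<dots> = (\<integral>\<^sup>+ x. ?f x + ?f (- x) \<partial>lborel)"
    by (subst nn_integral_add) auto
  also have "\<dots> = (\<integral>\<^sup>+x. ennreal (indicator {-1..1} x * (\<bar>x\<bar> * sqrt (1 - x\<^sup>2) ^ n)) \<partial>lborel)"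
  \<comment> \<open>The endpoints are excluded because for \<open>n = 0\<close> the two forms of the
    power disagree there: \<open>0 powr 0 = 0\<close>, but \<open>0 ^ 0 = 1\<close>.\<close>
  proof (intro nn_integral_cong_AE AE_I[of _ _ "{1, -1}"])
    show "{x \<in> space lborel. \<not> ?f x + ?f (- x) = ennreal (indicator {-1..1} x * (\<bar>x\<bar> * sqrt (1 - x\<^sup>2) ^ n))}
      \<subseteq> {1, -1}"
    proof (clarsimp, rule ccontr)
      fix x :: real
      assume ne: "?f x + ennreal (- (x * (1 - x\<^sup>2) powr (real n / 2) * indicator {0..1} (- x)))
          \<noteq> ennreal (indicator {-1..1} x * (\<bar>x\<bar> * sqrt (1 - x\<^sup>2) ^ n))"
        and "x \<noteq> 1" "x \<noteq> - 1"
      show False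
      proof (cases "\<bar>x\<bar> < 1")
        case True
        then have pos: "0 < 1 - x\<^sup>2" by (simp add: abs_square_less_1)
        then have "sqrt (1 - x\<^sup>2) ^ n = (1 - x\<^sup>2) powr (real n / 2)"
          by (simp add: powr_half_sqrt[symmetric] powr_realpow[symmetric] powr_powr)
        then show False
          using ne True by (cases x "0::real" rule: linorder_cases) (auto simp: indicator_def)
      next
        case False
        then show False
          using ne \<open>x \<noteq> 1\<close> \<open>x \<noteq> -1\<close> by (cases x "0::real" rule: linorder_cases) (auto simp: indicator_def)
      qed
    qed
  qed (auto simp: emeasure_lborel_countable)
  finally show ?thesis using B by simp
qed

text \<open>Slicing orthogonally to \<open>e\<close>: the slice at height \<open>y\<close> is a ball
  of radius \<open>sqrt (1 - y\<^sup>2)\<close> in one dimension less, which leaves the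
  one-dimensional integral of \<open>nn_integral_abs_sqrt_power\<close> with exponent
  \<open>DIM('a) - 1\<close>.\<close>

lemma nn_integral_cball_abs_inner_Basis:
  fixes e :: "'a::euclidean_space"
  assumes e: "e \<in> Basis"
  shows "(\<integral>\<^sup>+x. ennreal \<bar>x \<bullet> e\<bar> * indicator (cball 0 1) x \<partial>lborel)
    = ennreal (unit_ball_vol (real (DIM('a) - 1)) * (2 / (real DIM('a) + 1)))"
proof -
  define A where "A = Basis - {e}"
  have A: "finite A" "e \<notin> A" "insert e A = Basis" and cA: "card A = DIM('a) - 1"
    using e by (auto simp: A_def)
  interpret product_sigma_finite "\<lambda>_. lborel" by standard
  let ?P = "\<lambda>I. Pi\<^sub>M I (\<lambda>_. lborel :: real measure)"
  let ?S = "\<lambda>I r. {f. sqrt (\<Sum>i\<in>I. (f i)\<^sup>2) \<le> r}"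
  have "(\<integral>\<^sup>+x. ennreal \<bar>x \<bullet> e\<bar> * indicator (cball 0 1) x \<partial>(lborel :: 'a measure))
    = (\<integral>\<^sup>+f. ennreal \<bar>f e\<bar> * indicator (?S Basis 1) f \<partial>?P Basis)"
  proof (subst lborel_eq, subst nn_integral_distr)
    have inn: "(\<Sum>b\<in>Basis. f b *\<^sub>R b) \<bullet> b' = f b'" if "b' \<in> Basis" for f and b' :: 'a
      using that by (simp add: inner_sum_left inner_Basis if_distrib cong: if_cong)
    have "norm (\<Sum>b\<in>Basis. f b *\<^sub>R b :: 'a) = sqrt (\<Sum>i\<in>Basis. (f i)\<^sup>2)" for f
      by (subst euclidean_dist_l2[where x=0, unfolded dist_0_norm]) (simp add: L2_set_def inn)
    then show "(\<integral>\<^sup>+f. ennreal \<bar>(\<Sum>b\<in>Basis. f b *\<^sub>R b) \<bullet> e\<bar> * indicator (cball 0 1) (\<Sum>b\<in>Basis. f b *\<^sub>R b :: 'a) \<partial>?P Basis)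
      = (\<integral>\<^sup>+f. ennreal \<bar>f e\<bar> * indicator (?S Basis 1) f \<partial>?P Basis)"
      using e by (intro nn_integral_cong) (simp add: inn indicator_def)
  qed measurable
  also have "\<dots> = (\<integral>\<^sup>+ y. \<integral>\<^sup>+ x. ennreal \<bar>y\<bar> * indicator (?S (insert e A) 1) (x(e := y)) \<partial>?P A \<partial>lborel)"
    unfolding A(3)[symmetric] using A(1,2) by (subst product_nn_integral_insert_rev) auto
  also have "\<dots> = (\<integral>\<^sup>+ y. \<integral>\<^sup>+ x. ennreal (indicator {-1..1} y * \<bar>y\<bar>) * indicator (?S A (sqrt (1 - y\<^sup>2)) \<inter> space (?P A)) x
      \<partial>?P A \<partial>lborel)"
  proof (intro nn_integral_cong)
    fix y :: real and f assume f: "f \<in> space (?P A)"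
    have *: "(\<Sum>x\<in>A. ((f(e := y)) x)\<^sup>2) = (\<Sum>x\<in>A. (f x)\<^sup>2)"
      using A by (intro sum.cong) auto
    have **: "\<bar>y\<bar> \<le> 1" if "y\<^sup>2 + c \<le> 1" "c \<ge> 0" for c
      using that abs_square_le_1[of y] by linarith
    show "ennreal \<bar>y\<bar> * indicator (?S (insert e A) 1) (f(e := y))
      = ennreal (indicator {-1..1} y * \<bar>y\<bar>) * indicator (?S A (sqrt (1 - y\<^sup>2)) \<inter> space (?P A)) f"
      using f A(1,2) * **[of "\<Sum>x\<in>A. (f x)\<^sup>2"] by (auto simp: indicator_def sum_nonneg abs_le_iff)
  qed
  also have "\<dots> = (\<integral>\<^sup>+ y. ennreal (indicator {-1..1} y * \<bar>y\<bar>) * emeasure (?P A) (?S A (sqrt (1 - y\<^sup>2)) \<inter> space (?P A)) \<partial>lborel)"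
    using A(1) by (intro nn_integral_cong) (subst nn_integral_cmult_indicator, auto)
  also have "\<dots> = (\<integral>\<^sup>+ y. ennreal (unit_ball_vol (real (card A))) *
      ennreal (indicator {-1..1} y * (\<bar>y\<bar> * sqrt (1 - y\<^sup>2) ^ card A)) \<partial>lborel)"
  \<comment> \<open>At the heights -1 and 1 the slice has radius 0, whereas the volume formula for
    balls is applied to positive radii.\<close>
  proof (intro nn_integral_cong_AE)
    have "AE y in lborel. y \<notin> {-1,1::real}"
      by (intro AE_not_in countable_imp_null_set_lborel) auto
    then show "AE y in lborel. ennreal (indicator {-1..1} y * \<bar>y\<bar>) * emeasure (?P A) (?S A (sqrt (1 - y\<^sup>2)) \<inter> space (?P A))
      = ennreal (unit_ball_vol (real (card A))) * ennreal (indicator {-1..1} y * (\<bar>y\<bar> * sqrt (1 - y\<^sup>2) ^ card A))"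
    proof eventually_elim
      case (elim y)
      show ?case
      proof (cases "\<bar>y\<bar> < 1")
        case True
        then have "0 < sqrt (1 - y\<^sup>2)" by (simp add: abs_square_less_1)
        then show ?thesis
          using True A(1) by (subst emeasure_cball_aux)
            (auto simp: ennreal_mult'[symmetric] mult_ac indicator_def)
      qed (use elim in \<open>auto simp: indicator_def\<close>)
    qed
  qed
  also have "\<dots> = ennreal (unit_ball_vol (real (card A))) * ennreal (2 / (real (card A) + 2))"
    by (simp add: nn_integral_cmult nn_integral_abs_sqrt_power)
  also have "real (card A) + 2 = real DIM('a) + 1"
    using DIM_positive[where 'a='a] by (simp add: cA of_nat_diff Suc_leI)
  finally show ?thesis by (simp add: cA ennreal_mult'[symmetric])
qed

section \<open>Integration in the radial direction\<close>

lemma borel_measurable_sgn_euclidean [measurable]: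
  "sgn \<in> borel_measurable (borel :: 'a::euclidean_space measure)"
  unfolding sgn_div_norm[abs_def] by measurable

text \<open>Radial integration, via \<open>norm x + (\<integral>s\<in>{0..1}. of_bool (norm x < s)) = 1\<close> on the unit
  ball: scaling gives the second summand the weight \<open>1 / (DIM('a) + 1)\<close>.\<close>
lemma nn_integral_ball_sgn:
  fixes g :: "'a::euclidean_space \<Rightarrow> real"
  assumes g [measurable]: "g \<in> borel_measurable borel" and g0: "\<And>x. 0 \<le> g x" and gB: "\<And>x. g (sgn x) \<le> B"
  shows "(\<integral>\<^sup>+x. ennreal (g (sgn x)) * indicator (ball 0 1) x \<partial>lborel)
    = ennreal ((real DIM('a) + 1) / real DIM('a)) *
      (\<integral>\<^sup>+x. ennreal (norm x * g (sgn x)) * indicator (ball 0 1) x \<partial>lborel)"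
proof -
  let ?L = "lborel :: 'a measure"
  define D where "D = real DIM('a)"
  have D: "D > 0" by (simp add: D_def)
  define I where "I s = (\<integral>\<^sup>+x. ennreal (g (sgn x)) * indicator (ball 0 s) x \<partial>?L)" for s
  define W where "W = (\<integral>\<^sup>+x. ennreal (norm x * g (sgn x)) * indicator (ball 0 1) x \<partial>?L)"
  \<comment> \<open>\<open>sgn\<close> is invariant under positive scaling, so only the volume
    factor changes.\<close>
  have scale: "I s = ennreal (s ^ DIM('a)) * I 1" if s: "0 < s" for s
  proof -
    have "I s = (\<integral>\<^sup>+x. ennreal (g (sgn x)) * indicator (ball 0 s) x
        \<partial>density (distr lborel borel (\<lambda>x. 0 + s *\<^sub>R x)) (\<lambda>_. \<bar>s\<bar> ^ DIM('a)))"
      unfolding I_def using lborel_affine[of s "0::'a"] s by simp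
    also have "\<dots> = (\<integral>\<^sup>+x. ennreal (s ^ DIM('a)) * (ennreal (g (sgn x)) * indicator (ball 0 1) x) \<partial>?L)"
    proof (subst nn_integral_density, measurable, subst nn_integral_distr, measurable, rule nn_integral_cong)
      fix x :: 'a
      show "ennreal (\<bar>s\<bar> ^ DIM('a)) * (ennreal (g (sgn (0 + s *\<^sub>R x))) * indicator (ball 0 s) (0 + s *\<^sub>R x))
        = ennreal (s ^ DIM('a)) * (ennreal (g (sgn x)) * indicator (ball 0 1) x)"
        using s by (simp add: indicator_def sgn_scaleR)
    qed
    also have "\<dots> = ennreal (s ^ DIM('a)) * I 1"
      unfolding I_def by (rule nn_integral_cmult) measurable
    finally show ?thesis .
  qed
  have "((\<lambda>s. s ^ (DIM('a) + 1) / (D + 1)) has_real_derivative s ^ DIM('a)) (at s)" for s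
    using DERIV_cdivide[OF DERIV_pow[of "DIM('a) + 1" s], of "D + 1"] D by (simp add: D_def add.commute)
  then have FTC: "(\<integral>\<^sup>+s. ennreal (s ^ DIM('a)) * indicator {0..1} s \<partial>lborel) = ennreal (1 / (D + 1))"
    by (subst nn_integral_FTC_Icc[where F="\<lambda>s. s ^ (DIM('a) + 1) / (D + 1)"])
      auto
  have "I 1 = (\<integral>\<^sup>+x. (ennreal (norm x * g (sgn x)) * indicator (ball 0 1) x +
      (\<integral>\<^sup>+s. ennreal (g (sgn x)) * indicator (ball 0 s) x * indicator {0..1} s \<partial>lborel)) \<partial>?L)"
    unfolding I_def
  proof (rule nn_integral_cong)
    fix x :: 'a
    have "(\<integral>\<^sup>+s. ennreal (g (sgn x)) * indicator (ball 0 s) x * indicator {0..1} s \<partial>lborel)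
      = (\<integral>\<^sup>+s. ennreal (g (sgn x)) * indicator {norm x<..1} s \<partial>lborel)"
      by (rule nn_integral_cong) (use norm_ge_zero[of x] in \<open>auto simp: indicator_def simp del: norm_ge_zero\<close>)
    also have "\<dots> = ennreal (g (sgn x)) * emeasure lborel {norm x<..1}"
      by (simp add: nn_integral_cmult_indicator)
    finally have eq: "(\<integral>\<^sup>+s. ennreal (g (sgn x)) * indicator (ball 0 s) x * indicator {0..1} s \<partial>lborel)
      = ennreal (g (sgn x)) * emeasure lborel {norm x<..1}" .
    show "ennreal (g (sgn x)) * indicator (ball 0 1) x = ennreal (norm x * g (sgn x)) * indicator (ball 0 1) x +
      (\<integral>\<^sup>+s. ennreal (g (sgn x)) * indicator (ball 0 s) x * indicator {0..1} s \<partial>lborel)"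
    proof (cases "norm x < 1")
      case True
      then show ?thesis unfolding eq
        using g0[of "sgn x"] mult_right_mono[of "norm x" 1 "g (sgn x)"]
        by (simp add: ennreal_mult[symmetric] ennreal_plus[symmetric] algebra_simps del: ennreal_plus)
    next
      case False
      then show ?thesis unfolding eq by simp
    qed
  qed
  also have "\<dots> = W + (\<integral>\<^sup>+x. (\<integral>\<^sup>+s. ennreal (g (sgn x)) * indicator (ball 0 s) x * indicator {0..1} s \<partial>lborel) \<partial>?L)"
    unfolding W_def by (rule nn_integral_add) measurable
  also have "(\<integral>\<^sup>+x. (\<integral>\<^sup>+s. ennreal (g (sgn x)) * indicator (ball 0 s) x * indicator {0..1} s \<partial>lborel) \<partial>?L)
    = (\<integral>\<^sup>+s. (\<integral>\<^sup>+x. ennreal (g (sgn x)) * indicator (ball 0 s) x * indicator {0..1} s \<partial>?L) \<partial>lborel)"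
    by (rule lborel_pair.Fubini') measurable
  also have "\<dots> = (\<integral>\<^sup>+s. I 1 * (ennreal (s ^ DIM('a)) * indicator {0..1} s) \<partial>lborel)"
  proof (rule nn_integral_cong)
    fix s :: real
    have "(\<integral>\<^sup>+x. ennreal (g (sgn x)) * indicator (ball 0 s) x * indicator {0..1} s \<partial>?L) = I s * indicator {0..1} s"
      unfolding I_def by (simp add: nn_integral_multc)
    also have "\<dots> = I 1 * (ennreal (s ^ DIM('a)) * indicator {0..1} s)"
      \<comment> \<open>At \<open>s = 0\<close>, which \<open>scale\<close> leaves out, both sides
        vanish: the ball of radius 0 is empty and the dimension is positive.\<close>
      using scale[of s] by (cases "s = 0") (auto simp: indicator_def I_def mult.commute)
    finally show "(\<integral>\<^sup>+x. ennreal (g (sgn x)) * indicator (ball 0 s) x * indicator {0..1} s \<partial>?L) = \<dots>" .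
  qed
  also have "\<dots> = I 1 * ennreal (1 / (D + 1))"
    by (simp add: nn_integral_cmult FTC)
  finally have eq: "I 1 = W + I 1 * ennreal (1 / (D + 1))" .
  \<comment> \<open>Solving \<open>eq\<close> for \<open>I 1\<close> requires subtraction. The bound
    \<open>B\<close> makes \<open>I 1\<close> finite, so that the equation can be moved to the
    reals.\<close>
  have "I 1 \<le> (\<integral>\<^sup>+x. ennreal B * indicator (ball 0 1) x \<partial>?L)"
    unfolding I_def by (rule nn_integral_mono) (auto simp: indicator_def ennreal_leI gB)
  also have "\<dots> < \<infinity>"
    by (simp add: nn_integral_cmult emeasure_ball ennreal_mult_less_top)
  finally have fin: "I 1 < \<infinity>" .
  have "W \<le> I 1" by (subst eq) simp
  with fin have "W < \<infinity>" by (metis order.strict_trans1)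
  with fin obtain i w where iw: "0 \<le> i" "0 \<le> w" "I 1 = ennreal i" "W = ennreal w"
    by (metis ennreal_cases infinity_ennreal_def less_irrefl)
  with eq have "ennreal i = ennreal (w + i * (1 / (D + 1)))"
    using D by (simp add: ennreal_mult[symmetric])
  then have "i = w + i * (1 / (D + 1))"
    using iw D by (subst (asm) ennreal_inj) auto
  then have "i = (D + 1) / D * w"
    using D by (simp add: field_simps)
  then have "I 1 = ennreal ((D + 1) / D) * W"
    using iw D by (simp add: ennreal_mult[symmetric])
  then show ?thesis by (simp add: I_def W_def D_def)
qed

section \<open>The uniform measure on the sphere\<close>

lemma Gamma_half_step_le:
  fixes x :: real
  assumes "0 < x"
  shows "(Gamma (x + 1/2))\<^sup>2 \<le> Gamma x * Gamma (x + 1)"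
proof -
  have pos: "Gamma x > 0" "Gamma (x + 1) > 0" "Gamma (x + 1/2) > 0"
    using assms by (auto intro!: Gamma_real_pos)
  have "(ln \<circ> Gamma) ((1 - 1/2) *\<^sub>R x + (1/2) *\<^sub>R (x + 1))
      \<le> (1 - 1/2) * (ln \<circ> Gamma) x + (1/2) * (ln \<circ> Gamma) (x + 1)"
    by (rule convex_onD[OF log_convex_Gamma_real]) (use assms in auto)
  moreover have "(1 - 1/2) *\<^sub>R x + (1/2) *\<^sub>R (x + 1) = x + 1/2"
    by (simp add: field_simps)
  ultimately have "2 * ln (Gamma (x + 1/2)) \<le> ln (Gamma x) + ln (Gamma (x + 1))"
    by simp
  then have "ln ((Gamma (x + 1/2))\<^sup>2) \<le> ln (Gamma x * Gamma (x + 1))"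
    using pos by (simp add: ln_mult ln_realpow less_imp_neq[THEN not_sym])
  then show ?thesis
    using pos by (subst (asm) ln_le_cancel_iff) auto
qed

text \<open>The left-hand side is the mean of \<open>\<bar>x \<bullet> e\<bar>\<close> for a unit
  vector \<open>e\<close> and \<open>x\<close> uniform on the unit sphere in dimension
  \<open>d + 1\<close>. With \<open>x = d / 2\<close> it equals
  \<open>Gamma (x + 1/2) / (sqrt pi * Gamma (x + 1))\<close>; log-convexity and
  \<open>Gamma (x + 1) = x * Gamma x\<close> bound its square by
  \<open>1 / (pi * x)\<close>.\<close>

lemma unit_ball_vol_ratio_le:
  assumes "d \<ge> 1"
  shows "2 * unit_ball_vol (real d) / ((real d + 1) * unit_ball_vol (real d + 1)) \<le> sqrt (2 / (pi * real d))"
proof -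
  define x where "x = real d / 2"
  have x: "x > 0" using assms by (simp add: x_def)
  have nI: "x + 1/2 \<notin> \<int>\<^sub>\<le>\<^sub>0" "x \<notin> \<int>\<^sub>\<le>\<^sub>0"
    using x nonpos_Ints_nonpos[of "x + 1/2"] nonpos_Ints_nonpos[of x] by auto
  have pos: "Gamma x > 0" "Gamma (x + 1) > 0" "Gamma (x + 1/2) > 0"
    using x by (auto intro!: Gamma_real_pos)
  have "Gamma (x + 1/2 + 1) = (x + 1/2) * Gamma (x + 1/2)"
    by (rule Gamma_plus1[OF nI(1)])
  moreover have "pi powr (x + 1/2) = pi powr x * sqrt pi"
    by (simp add: powr_add powr_half_sqrt)
  moreover have "real d = 2 * x" by (simp add: x_def)
  \<comment> \<open>The cancellation is isolated with variables in place of the Gamma values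
    (\<open>a\<close>, \<open>b\<close>), the powers of \<open>pi\<close> (\<open>p\<close>,
    \<open>q\<close>) and \<open>x + 1/2\<close> (\<open>z\<close>), so that field arithmetic treats
    them as atoms.\<close>
  moreover have "2 * (p / b) / ((2 * z) * (p * q / (z * a))) = a / (q * b)"
    if "a > 0" "b > 0" "p > 0" "q > 0" "z > 0" for a b p q z :: real
    using that by (simp add: field_simps)
  from this[OF pos(3,2) _ _, of "pi powr x" "sqrt pi" "x + 1/2"]
  have "2 * (pi powr x / Gamma (x + 1)) / ((2 * (x + 1/2)) * (pi powr x * sqrt pi / ((x + 1/2) * Gamma (x + 1/2))))
      = Gamma (x + 1/2) / (sqrt pi * Gamma (x + 1))"
    using x by simp
  ultimately have "2 * unit_ball_vol (real d) / ((real d + 1) * unit_ball_vol (real d + 1))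
      = Gamma (x + 1/2) / (sqrt pi * Gamma (x + 1))"
    by (simp add: unit_ball_vol_def add_divide_distrib distrib_left)
  also have "\<dots> \<le> sqrt (1 / (pi * x))"
  proof (rule real_le_rsqrt)
    have "(Gamma (x + 1/2))\<^sup>2 * x \<le> Gamma x * Gamma (x + 1) * x"
      using Gamma_half_step_le[OF x] x by simp
    also have "\<dots> = (Gamma (x + 1))\<^sup>2"
      using Gamma_plus1[OF nI(2)] by (simp add: power2_eq_square)
    finally show "(Gamma (x + 1/2) / (sqrt pi * Gamma (x + 1)))\<^sup>2 \<le> 1 / (pi * x)"
      using x pos(2)[THEN less_imp_neq, THEN not_sym]
      by (simp add: power_divide power_mult_distrib divide_simps)
  qed
  also have "1 / (pi * x) = 2 / (pi * real d)"
    by (simp add: x_def)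
  finally show ?thesis .
qed

section \<open>Integrals of linear functions against the sphere measure\<close>

lemma sets_sphere_meas [simp, measurable_cong]: "sets sphere_meas = sets borel"
  by (simp add: sphere_meas_def)

lemma space_sphere_meas [simp]: "space sphere_meas = UNIV"
  by (simp add: sphere_meas_def)

lemma nn_integral_sphere_meas:
  fixes f :: "'a::euclidean_space \<Rightarrow> ennreal"
  assumes [measurable]: "f \<in> borel_measurable borel"
  shows "(\<integral>\<^sup>+x. f x \<partial>sphere_meas)
    = (\<integral>\<^sup>+x. f (sgn x) * indicator (ball 0 1) x \<partial>lborel) / ennreal (unit_ball_vol (real DIM('a)))"
proof -
  have "(\<integral>\<^sup>+x. f x \<partial>sphere_meas) = (\<integral>\<^sup>+x. f (sgn x) \<partial>uniform_measure lborel (ball 0 1))"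
    unfolding sphere_meas_def by (subst nn_integral_distr) auto
  also have "\<dots> = (\<integral>\<^sup>+x. f (sgn x) * indicator (ball 0 1) x \<partial>lborel) / ennreal (unit_ball_vol (real DIM('a)))"
    by (subst nn_integral_uniform_measure) (auto simp: emeasure_ball)
  finally show ?thesis .
qed

lemma prob_space_sphere_meas: "prob_space (sphere_meas :: 'a::euclidean_space measure)"
  unfolding sphere_meas_def
  by (intro prob_space.prob_space_distr prob_space_uniform_measure)
    (auto simp: emeasure_ball less_imp_neq[OF unit_ball_vol_pos, symmetric])

text \<open>The origin, a null set, is the only point that \<open>sgn\<close> does not send to the
  sphere.\<close>

lemma AE_sphere_meas: "AE x in (sphere_meas :: 'a::euclidean_space measure). x \<in> sphere 0 1"
proof -
  have "AE x in lborel. x \<notin> {0::'a}"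
    by (intro AE_not_in countable_imp_null_set_lborel) auto
  then have "AE x in lborel. (x :: 'a) \<in> ball 0 1 \<longrightarrow> norm (sgn x) = 1"
    by eventually_elim (simp add: norm_sgn)
  then have "AE x in uniform_measure lborel (ball 0 1). norm (sgn x :: 'a) = 1"
    by (intro AE_uniform_measureI) auto
  then show ?thesis
    unfolding sphere_meas_def by (subst AE_distr_iff) auto
qed

lemma integrable_sphere_meas_inner:
  fixes y :: "'a::euclidean_space"
  shows "integrable sphere_meas (\<lambda>x. x \<bullet> y)"
proof (rule finite_measure.integrable_const_bound[where B="norm y"])
  show "finite_measure (sphere_meas :: 'a measure)"
    using prob_space_sphere_meas by (rule prob_space.finite_measure)
  show "AE x in sphere_meas. norm (x \<bullet> y) \<le> norm y"
    using AE_sphere_meas by eventually_elim (metis Cauchy_Schwarz_ineq2 mem_sphere_0 mult_1 real_norm_def)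
qed simp

text \<open>Antipodal symmetry: \<open>x \<mapsto> - x\<close> preserves the measure and exchanges
  the positive and negative parts of the integrand.\<close>

lemma integral_sphere_meas_inner_eq_0:
  fixes y :: "'a::euclidean_space"
  shows "(\<integral>x. x \<bullet> y \<partial>sphere_meas) = 0"
proof -
  have "distr lborel borel uminus = (lborel :: 'a measure)"
    by (rule lborel_distr_isometry) (simp add: orthogonal_transformation_def linear_iff)
  then have "(\<integral>\<^sup>+x. ennreal (sgn x \<bullet> y) * indicator (ball 0 1) x \<partial>lborel)
      = (\<integral>\<^sup>+x. ennreal (sgn x \<bullet> y) * indicator (ball 0 1) x \<partial>distr lborel borel uminus)"
    by simp
  also have "\<dots> = (\<integral>\<^sup>+x. ennreal (sgn (- x) \<bullet> y) * indicator (ball 0 1) (- x) \<partial>lborel)"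
    by (rule nn_integral_distr) measurable
  also have "\<dots> = (\<integral>\<^sup>+x. ennreal (- (sgn x \<bullet> y)) * indicator (ball 0 1) x \<partial>lborel)"
    by (rule nn_integral_cong) (simp add: indicator_def sgn_minus)
  finally have "(\<integral>\<^sup>+x. ennreal (x \<bullet> y) \<partial>sphere_meas) = (\<integral>\<^sup>+x. ennreal (- (x \<bullet> y)) \<partial>sphere_meas)"
    by (simp add: nn_integral_sphere_meas)
  then show ?thesis
    using real_lebesgue_integral_def[of sphere_meas "\<lambda>x. x \<bullet> y"]
    by (cases "integrable sphere_meas (\<lambda>x. x \<bullet> y)") (auto simp: not_integrable_integral_eq)
qed

text \<open>Radial integration trades the sphere for the ball, rotation invariance replaces
  \<open>v\<close> by a basis vector, slicing evaluates the ball integral, and the volume ratio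
  supplies the constant.\<close>

lemma integral_sphere_meas_abs_inner_le:
  fixes v :: "'a::euclidean_space"
  assumes d: "DIM('a) = d + 1" "d \<ge> 1"
  shows "(\<integral>x. \<bar>x \<bullet> v\<bar> \<partial>sphere_meas) \<le> sqrt (2 / (pi * real d)) * norm v"
proof -
  obtain e :: 'a where e: "e \<in> Basis" using nonempty_Basis by blast
  define \<omega> where "\<omega> = unit_ball_vol (real d)"
  define \<omega>' where "\<omega>' = unit_ball_vol (real d + 1)"
  have pos: "\<omega> > 0" "\<omega>' > 0" by (simp_all add: \<omega>_def \<omega>'_def)
  have "(\<integral>\<^sup>+x. ennreal \<bar>sgn x \<bullet> v\<bar> * indicator (ball 0 1) x \<partial>lborel)
    = ennreal ((real DIM('a) + 1) / real DIM('a)) *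
      (\<integral>\<^sup>+x. ennreal (norm x * \<bar>sgn x \<bullet> v\<bar>) * indicator (ball 0 1) x \<partial>lborel)"
  proof (rule nn_integral_ball_sgn[where g="\<lambda>x. \<bar>x \<bullet> v\<bar>" and B="norm v"])
    fix x :: 'a
    have "\<bar>sgn x \<bullet> v\<bar> \<le> norm (sgn x) * norm v" by (rule Cauchy_Schwarz_ineq2)
    also have "\<dots> \<le> 1 * norm v" by (rule mult_right_mono) (auto simp: norm_sgn)
    finally show "\<bar>sgn x \<bullet> v\<bar> \<le> norm v" by simp
  qed auto
  also have "(\<integral>\<^sup>+x. ennreal (norm x * \<bar>sgn x \<bullet> v\<bar>) * indicator (ball 0 1) x \<partial>lborel)
    = (\<integral>\<^sup>+x. ennreal \<bar>x \<bullet> v\<bar> * indicator (ball 0 1) x \<partial>lborel)"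
  proof (rule nn_integral_cong)
    fix x :: 'a
    have "norm x * \<bar>sgn x \<bullet> v\<bar> = \<bar>(norm x *\<^sub>R sgn x) \<bullet> v\<bar>" by (simp add: abs_mult)
    also have "norm x *\<^sub>R sgn x = x" by (cases "x = 0") (simp_all add: sgn_div_norm)
    finally show "ennreal (norm x * \<bar>sgn x \<bullet> v\<bar>) * indicator (ball 0 1) x = ennreal \<bar>x \<bullet> v\<bar> * indicator (ball 0 1) x"
      by simp
  qed
  also have "\<dots> = ennreal (norm v) * (\<integral>\<^sup>+x. ennreal \<bar>x \<bullet> e\<bar> * indicator (ball 0 1) x \<partial>lborel)"
    using e by (intro nn_integral_ball_abs_inner) simp
  also have "(\<integral>\<^sup>+x. ennreal \<bar>x \<bullet> e\<bar> * indicator (ball 0 1) x \<partial>lborel)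
    \<le> (\<integral>\<^sup>+x. ennreal \<bar>x \<bullet> e\<bar> * indicator (cball 0 1) x \<partial>lborel)"
    by (rule nn_integral_mono) (auto simp: indicator_def)
  also have "\<dots> = ennreal (\<omega> * (2 / (real d + 2)))"
    using nn_integral_cball_abs_inner_Basis[OF e] d by (simp add: \<omega>_def add_ac)
  finally have *: "(\<integral>\<^sup>+x. ennreal \<bar>sgn x \<bullet> v\<bar> * indicator (ball 0 1) x \<partial>lborel)
    \<le> ennreal ((real d + 2) / (real d + 1) * (norm v * (\<omega> * (2 / (real d + 2)))))"
    using d pos by (simp add: ennreal_mult[symmetric] mult_left_mono add_ac)
  have "(\<integral>\<^sup>+x. ennreal \<bar>x \<bullet> v\<bar> \<partial>sphere_meas)
      = (\<integral>\<^sup>+x. ennreal \<bar>sgn x \<bullet> v\<bar> * indicator (ball 0 1) x \<partial>lborel) / ennreal \<omega>'"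
    using d by (simp add: nn_integral_sphere_meas \<omega>'_def add_ac)
  also have "\<dots> \<le> ennreal ((real d + 2) / (real d + 1) * (norm v * (\<omega> * (2 / (real d + 2))))) / ennreal \<omega>'"
    by (rule divide_right_mono_ennreal[OF *])
  also have "\<dots> = ennreal (2 * \<omega> / ((real d + 1) * \<omega>') * norm v)"
  proof (subst divide_ennreal)
    \<comment> \<open>The factor \<open>d + 2\<close> from radial integration cancels the
      denominator \<open>d + 2\<close> of the slice integral.\<close>
    have "(a + 2) / (a + 1) * (b * (c * (2 / (a + 2)))) / c' = 2 * c / ((a + 1) * c') * b" if "a \<ge> 0" "c' > 0"
      for a b c c' :: real
      using that by (simp add: divide_simps)
    from this[of "real d" \<omega>' "norm v" \<omega>] pos
    show "ennreal ((real d + 2) / (real d + 1) * (norm v * (\<omega> * (2 / (real d + 2)))) / \<omega>')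
        = ennreal (2 * \<omega> / ((real d + 1) * \<omega>') * norm v)"
      by simp
  qed (use pos in auto)
  also have "\<dots> \<le> ennreal (sqrt (2 / (pi * real d)) * norm v)"
    unfolding \<omega>_def \<omega>'_def by (intro ennreal_leI mult_right_mono unit_ball_vol_ratio_le d) auto
  finally have "(\<integral>\<^sup>+x. ennreal \<bar>x \<bullet> v\<bar> \<partial>sphere_meas) \<le> ennreal (sqrt (2 / (pi * real d)) * norm v)" .
  then show ?thesis
    by (intro integral_real_bounded) auto
qed

section \<open>Spherical caps\<close>

interpretation sphere_meas: prob_space "sphere_meas :: 'a::euclidean_space measure"
  by (rule prob_space_sphere_meas)

lemma prob_sphere_meas_UNIV [simp]: "sphere_meas.prob UNIV = 1"
  using sphere_meas.prob_space by simp

text \<open>Encoded as a density so that the space is \<open>UNIV\<close> and the measurable sets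
  are all Borel sets. The open interval matches \<open>einterval\<close>, which underlies the
  interval integral in \<open>L2cap\<close>.\<close>

definition cap_heights :: "real measure" where
  "cap_heights = density lborel (indicator {-1<..<1})"

lemma sets_cap_heights [simp, measurable_cong]: "sets cap_heights = sets borel"
  by (simp add: cap_heights_def)

lemma space_cap_heights [simp]: "space cap_heights = UNIV"
  by (simp add: cap_heights_def)

lemma emeasure_cap_heights:
  assumes "A \<in> sets borel"
  shows "emeasure cap_heights A = emeasure lborel ({-1<..<1} \<inter> A)"
  unfolding cap_heights_def using assms
  by (subst emeasure_density) (auto simp: indicator_inter_arith[symmetric])

interpretation cap_heights: finite_measure cap_heights
  by (rule finite_measureI) (simp add: emeasure_cap_heights)

lemma LBINT_eq_integral_cap_heights:
  fixes f :: "real \<Rightarrow> real"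
  assumes [measurable]: "f \<in> borel_measurable borel"
  shows "(LBINT t=-1..1. f t) = (\<integral>t. f t \<partial>cap_heights)"
proof -
  have "(\<integral>t. f t \<partial>cap_heights) = (\<integral>t. f t \<partial>density lborel (\<lambda>t. ennreal (indicator {-1<..<1} t)))"
    unfolding cap_heights_def by (simp add: ennreal_indicator)
  also have "\<dots> = (LBINT t:{-1<..<1}. f t)"
    by (subst integral_density) (simp_all add: set_lebesgue_integral_def)
  finally have eq: "(\<integral>t. f t \<partial>cap_heights) = (LBINT t:{-1<..<1}. f t)" .
  have "einterval (-1) 1 = {-1<..<1::real}"
    by (auto simp: einterval_def one_ereal_def)
  moreover have "(-1::ereal) \<le> 1"
    by (simp add: one_ereal_def)
  ultimately have "(LBINT t:{-1<..<1}. f t) = (LBINT t=-1..1. f t)"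
    by (simp add: interval_lebesgue_integral_def)
  with eq show ?thesis by simp
qed

section \<open>The space of caps, indicators and areas\<close>

abbreviation cap_params :: "(real \<times> 'a::euclidean_space) measure" where
  "cap_params \<equiv> cap_heights \<Otimes>\<^sub>M sphere_meas"

interpretation cap_params: pair_sigma_finite cap_heights "sphere_meas :: 'a::euclidean_space measure" ..

interpretation cap_params: finite_measure "cap_params :: (real \<times> 'a::euclidean_space) measure"
  by (rule finite_measure_pair_measure) (rule cap_heights.finite_measure_axioms sphere_meas.finite_measure_axioms)+

text \<open>Caps are parametrised by pairs of height and centre.\<close>
definition cap_ind :: "real \<times> 'a::euclidean_space \<Rightarrow> 'a \<Rightarrow> real" where
  "cap_ind p y = indicator (cap (snd p) (fst p)) y"

definition cap_area :: "real \<times> 'a::euclidean_space \<Rightarrow> real" where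
  "cap_area p = (\<integral>y. cap_ind p y \<partial>sphere_meas)"

lemma cap_in_borel [measurable]: "cap x t \<in> sets borel"
  unfolding cap_def by measurable

lemma measurable_cap_ind [measurable (raw)]:
  fixes g :: "'b \<Rightarrow> 'a::euclidean_space"
  assumes "f \<in> M \<rightarrow>\<^sub>M borel \<Otimes>\<^sub>M borel" and [measurable]: "g \<in> borel_measurable M"
  shows "(\<lambda>z. cap_ind (f z) (g z)) \<in> borel_measurable M"
proof -
  note [measurable] = assms(1)
  have "(\<lambda>z. cap_ind (f z) (g z)) = (\<lambda>z. if norm (g z) = 1 \<and> fst (f z) \<le> snd (f z) \<bullet> g z then 1 else 0)"
    by (auto simp: cap_ind_def cap_def indicator_def)
  then show ?thesis by simp
qed

lemma cap_ind_bounds: "0 \<le> cap_ind p y" "cap_ind p y \<le> 1" "\<bar>cap_ind p y\<bar> \<le> 1" "(cap_ind p y)\<^sup>2 = cap_ind p y"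
  by (simp_all add: cap_ind_def indicator_def)

lemma cap_area_eq_measure: "cap_area (t, x) = measure sphere_meas (cap x t)"
proof -
  have "cap_area (t, x) = (\<integral>y. indicator (cap x t) y \<partial>sphere_meas)"
    by (simp add: cap_area_def cap_ind_def)
  then show ?thesis by simp
qed

lemma cap_area_bounds: "0 \<le> cap_area p" "cap_area p \<le> 1"
  by (cases p; simp add: cap_area_eq_measure)+

lemma measurable_cap_area [measurable]: "cap_area \<in> borel_measurable (borel \<Otimes>\<^sub>M borel)"
  unfolding cap_area_def[abs_def] by measurable

lemma integrable_cap_ind: "integrable sphere_meas (cap_ind p)"
proof (rule sphere_meas.integrable_const_bound[where B=1])
  have "p \<in> space (borel \<Otimes>\<^sub>M borel)" by (simp add: space_pair_measure)
  then show "cap_ind p \<in> borel_measurable sphere_meas"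
    by measurable
qed (simp add: cap_ind_bounds)

text \<open>Both orders of Fubini: heights innermost for explicit computations, centres innermost to
  match the definitions of the discrepancies.\<close>

lemma integral_cap_params:
  fixes f :: "real \<times> 'a::euclidean_space \<Rightarrow> real"
  assumes [measurable]: "f \<in> borel_measurable (borel \<Otimes>\<^sub>M borel)" and B: "\<And>p. \<bar>f p\<bar> \<le> B"
  shows "(\<integral>p. f p \<partial>cap_params) = (\<integral>x. (\<integral>t. f (t, x) \<partial>cap_heights) \<partial>sphere_meas)"
    and "(\<integral>p. f p \<partial>cap_params) = (LBINT t=-1..1. (\<integral>x. f (t, x) \<partial>sphere_meas))"
proof -
  have "integrable cap_params f"
    by (rule cap_params.integrable_const_bound[where B=B]) (use B in auto)
  then show "(\<integral>p. f p \<partial>cap_params) = (\<integral>x. (\<integral>t. f (t, x) \<partial>cap_heights) \<partial>sphere_meas)"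
    "(\<integral>p. f p \<partial>cap_params) = (LBINT t=-1..1. (\<integral>x. f (t, x) \<partial>sphere_meas))"
    using cap_params.integral_snd[of "\<lambda>t x. f (t, x)"] cap_params.integral_fst[of "\<lambda>t x. f (t, x)"]
    by (simp_all add: LBINT_eq_integral_cap_heights)
qed

text \<open>The caps centred at \<open>x\<close> that contain \<open>y\<close> are those of height
  at most \<open>x \<bullet> y\<close>, so the integral is the length of the part of (-1,1) up to
  \<open>x \<bullet> y\<close>.\<close>

lemma integral_cap_heights_cap_ind:
  assumes "norm x = 1" "norm y = 1"
  shows "(\<integral>t. cap_ind (t, x) y \<partial>cap_heights) = 1 + x \<bullet> y"
proof -
  have le: "\<bar>x \<bullet> y\<bar> \<le> 1" using Cauchy_Schwarz_ineq2[of x y] assms by simp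
  have "(\<integral>t. cap_ind (t, x) y \<partial>cap_heights) = (\<integral>t. indicator {..x \<bullet> y} t \<partial>cap_heights)"
    by (rule Bochner_Integration.integral_cong) (use assms in \<open>auto simp: cap_ind_def cap_def indicator_def\<close>)
  also have "\<dots> = measure cap_heights {..x \<bullet> y}" by simp
  also have "\<dots> = measure lborel ({-1<..<1} \<inter> {..x \<bullet> y})"
    by (simp add: measure_def emeasure_cap_heights)
  also have "\<dots> = 1 + x \<bullet> y"
  \<comment> \<open>Only for \<open>x \<bullet> y = 1\<close> is the right endpoint missing, since
    the heights range over an open interval.\<close>
  proof (cases "x \<bullet> y = 1")
    case True
    then have "{-1<..<1} \<inter> {..x \<bullet> y} = {-1<..<1}" by auto
    then show ?thesis using True by simp
  next
    case False
    then have "{-1<..<1} \<inter> {..x \<bullet> y} = {-1<..x \<bullet> y}" using le by auto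
    then show ?thesis using le by simp
  qed
  finally show ?thesis .
qed

text \<open>The heights at which a cap centred at \<open>x\<close> separates \<open>y\<close> from
  \<open>y'\<close> lie between \<open>x \<bullet> y\<close> and \<open>x \<bullet> y'\<close>. For
  arbitrary \<open>x\<close> this interval may stick out of (-1,1), hence the inequality.\<close>

lemma integral_cap_heights_cap_ind_diff_le:
  assumes "norm y = 1" "norm y' = 1"
  shows "(\<integral>t. \<bar>cap_ind (t, x) y - cap_ind (t, x) y'\<bar> \<partial>cap_heights) \<le> \<bar>x \<bullet> (y - y')\<bar>"
proof -
  let ?I = "{min (x \<bullet> y) (x \<bullet> y')<..max (x \<bullet> y) (x \<bullet> y')}"
  have "(\<integral>t. \<bar>cap_ind (t, x) y - cap_ind (t, x) y'\<bar> \<partial>cap_heights) = (\<integral>t. indicator ?I t \<partial>cap_heights)"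
    by (rule Bochner_Integration.integral_cong) (use assms in \<open>auto simp: cap_ind_def cap_def indicator_def\<close>)
  also have "\<dots> = measure lborel ({-1<..<1} \<inter> ?I)"
    by (simp add: measure_def emeasure_cap_heights)
  also have "\<dots> \<le> measure lborel ?I"
    by (rule measure_mono_fmeasurable) (auto simp: fmeasurable_def)
  also have "\<dots> = \<bar>x \<bullet> (y - y')\<bar>"
    by (simp add: inner_diff_right)
  finally show ?thesis .
qed

text \<open>Taking \<open>1 / N\<close> out of the square leaves the unnormalised sum that
  \<open>greedy_points\<close> controls.\<close>

lemma L2cap_eq:
  assumes "N \<ge> 1"
  shows "L2cap X N = sqrt (\<integral>p. ((\<Sum>n<N. cap_ind p (X n) - cap_area p))\<^sup>2 \<partial>cap_params) / real N"
proof -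
  let ?f = "\<lambda>p. ((1 / real N) * (\<Sum>n<N. cap_ind p (X n)) - cap_area p)\<^sup>2"
  have "\<bar>?f p\<bar> \<le> 1" for p
  proof -
    have "(\<Sum>n<N. cap_ind p (X n)) \<le> (\<Sum>n<N. 1)"
      by (rule sum_mono) (rule cap_ind_bounds)
    then have "(1 / real N) * (\<Sum>n<N. cap_ind p (X n)) \<le> 1"
      using assms by simp
    moreover have "0 \<le> (1 / real N) * (\<Sum>n<N. cap_ind p (X n))"
      by (simp add: sum_nonneg cap_ind_bounds)
    ultimately have "\<bar>(1 / real N) * (\<Sum>n<N. cap_ind p (X n)) - cap_area p\<bar> \<le> 1"
      using cap_area_bounds[of p] by linarith
    then show ?thesis by (simp add: abs_square_le_1)
  qed
  then have "(\<integral>p. ?f p \<partial>cap_params) = (LBINT t=-1..1. (\<integral>x. ?f (t, x) \<partial>sphere_meas))"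
    by (intro integral_cap_params(2)) simp_all
  then have "L2cap X N = sqrt (\<integral>p. ?f p \<partial>cap_params)"
    by (simp add: L2cap_def cap_area_eq_measure cap_ind_def)
  also have "(\<lambda>p. ?f p) = (\<lambda>p. (1 / (real N)\<^sup>2) * (\<Sum>n<N. cap_ind p (X n) - cap_area p)\<^sup>2)"
    using assms by (simp add: sum_subtractf power2_eq_square field_simps)
  also have "sqrt (\<integral>p. (1 / (real N)\<^sup>2) * (\<Sum>n<N. cap_ind p (X n) - cap_area p)\<^sup>2 \<partial>cap_params)
      = sqrt (\<integral>p. ((\<Sum>n<N. cap_ind p (X n) - cap_area p))\<^sup>2 \<partial>cap_params) / real N"
    by (simp add: real_sqrt_mult real_sqrt_divide)
  finally show ?thesis .
qed

lemma L2cap_empty_eq: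
  "L2cap_empty TYPE('a::euclidean_space) = sqrt (\<integral>p. (cap_area p)\<^sup>2 \<partial>(cap_params :: (real \<times> 'a) measure))"
  by (subst integral_cap_params(2)[where B=1])
    (auto simp: L2cap_empty_def cap_area_eq_measure abs_square_le_1)

text \<open>After interchanging integrals, a fixed \<open>y\<close> on the sphere lies in caps
  centred at \<open>x\<close> for heights of total length \<open>1 + x \<bullet> y\<close>, and the
  inner product averages to 0 over \<open>x\<close>.\<close>

lemma integral_cap_area: "(\<integral>p. cap_area p \<partial>(cap_params :: (real \<times> 'a::euclidean_space) measure)) = 1"
proof -
  have "(\<integral>p. cap_area p \<partial>(cap_params :: (real \<times> 'a) measure))
      = (\<integral>y. (\<integral>p. cap_ind p y \<partial>cap_params) \<partial>(sphere_meas :: 'a measure))"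
    unfolding cap_area_def
    by (rule integral_swap_bounded[where B=1])
      (auto simp: cap_ind_bounds cap_params.finite_measure_axioms sphere_meas.finite_measure_axioms)
  also have "\<dots> = (\<integral>y. (\<integral>x. (\<integral>t. cap_ind (t, x) y \<partial>cap_heights) \<partial>sphere_meas) \<partial>(sphere_meas :: 'a measure))"
    by (subst integral_cap_params(1)[where B=1]) (auto simp: cap_ind_bounds)
  also have "\<dots> = (\<integral>y. 1 \<partial>(sphere_meas :: 'a measure))"
  proof (rule integral_cong_AE)
    show "AE y in (sphere_meas :: 'a measure). (\<integral>x. (\<integral>t. cap_ind (t, x) y \<partial>cap_heights) \<partial>sphere_meas) = 1"
      using AE_sphere_meas
    proof eventually_elim
      case (elim y)
      have "(\<integral>x. (\<integral>t. cap_ind (t, x) y \<partial>cap_heights) \<partial>sphere_meas) = (\<integral>x. 1 + x \<bullet> y \<partial>sphere_meas)"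
      proof (rule integral_cong_AE)
        show "AE x in sphere_meas. (\<integral>t. cap_ind (t, x) y \<partial>cap_heights) = 1 + x \<bullet> y"
          using AE_sphere_meas
          by eventually_elim (use elim in \<open>simp add: integral_cap_heights_cap_ind\<close>)
      qed measurable
      also have "\<dots> = 1"
        by (simp add: integral_sphere_meas_inner_eq_0 integrable_sphere_meas_inner sphere_meas.prob_space)
      finally show ?case .
    qed
  qed measurable
  finally show ?thesis by (simp add: sphere_meas.prob_space)
qed

section \<open>The variance of cap indicators through separated pairs of points\<close>

lemma integral_cap_ind_variance: "(\<integral>y. (cap_ind p y - cap_area p)\<^sup>2 \<partial>sphere_meas) = cap_area p - (cap_area p)\<^sup>2"
proof -
  have "(cap_ind p y - cap_area p)\<^sup>2 = (1 - 2 * cap_area p) * cap_ind p y + (cap_area p)\<^sup>2" for y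
    by (simp add: power2_diff cap_ind_bounds algebra_simps)
  then have "(\<integral>y. (cap_ind p y - cap_area p)\<^sup>2 \<partial>sphere_meas) = (1 - 2 * cap_area p) * cap_area p + (cap_area p)\<^sup>2"
    using integrable_cap_ind[of p] by (simp add: cap_area_def[symmetric] sphere_meas.prob_space)
  then show ?thesis by (simp add: power2_eq_square algebra_simps)
qed

text \<open>Two independent points are separated by a cap of area \<open>a\<close> with probability
  \<open>2 * a * (1 - a)\<close>, twice the variance of its indicator. This lets the variance be
  bounded through pairs of points.\<close>

lemma integral_cap_ind_abs_diff:
  "(\<integral>y. (\<integral>y'. \<bar>cap_ind p y - cap_ind p y'\<bar> \<partial>sphere_meas) \<partial>sphere_meas) = 2 * (cap_area p - (cap_area p)\<^sup>2)"
proof -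
  \<comment> \<open>For values in {0,1} the absolute difference is affine in each argument, so it
    can be integrated term by term.\<close>
  have "\<bar>cap_ind p y - cap_ind p y'\<bar> = (1 - 2 * cap_ind p y) * cap_ind p y' + cap_ind p y" for y y'
    by (simp add: cap_ind_def indicator_def)
  then have "(\<integral>y'. \<bar>cap_ind p y - cap_ind p y'\<bar> \<partial>sphere_meas) = (1 - 2 * cap_area p) * cap_ind p y + cap_area p" for y
    using integrable_cap_ind[of p] by (simp add: cap_area_def[symmetric]) (simp add: algebra_simps)
  then have "(\<integral>y. (\<integral>y'. \<bar>cap_ind p y - cap_ind p y'\<bar> \<partial>sphere_meas) \<partial>sphere_meas)
      = (\<integral>y. (1 - 2 * cap_area p) * cap_ind p y + cap_area p \<partial>sphere_meas)"
    by simp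
  also have "\<dots> = (1 - 2 * cap_area p) * cap_area p + cap_area p"
    using integrable_cap_ind[of p] by (simp add: cap_area_def[symmetric] sphere_meas.prob_space)
  finally show ?thesis by (simp add: power2_eq_square algebra_simps)
qed

text \<open>The squared distance \<open>2 - 2 * (y' \<bullet> y)\<close> has mean 2. In place of
  Jensen's inequality, \<open>0 \<le> (norm (y - y') - sqrt 2)\<^sup>2\<close> gives a pointwise
  bound linear in \<open>y'\<close> whose mean is \<open>sqrt 2\<close>.\<close>

lemma integral_sphere_meas_norm_diff_le:
  fixes y :: "'a::euclidean_space"
  assumes "norm y = 1"
  shows "integrable sphere_meas (\<lambda>y'. norm (y - y'))" "(\<integral>y'. norm (y - y') \<partial>sphere_meas) \<le> sqrt 2"
proof -
  have AE2: "AE y' in sphere_meas. norm (y - y') \<le> 2"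
    using AE_sphere_meas
  proof eventually_elim
    case (elim y')
    then show ?case using assms norm_triangle_ineq4[of y y'] by simp
  qed
  then show int: "integrable sphere_meas (\<lambda>y'. norm (y - y'))"
    by (intro sphere_meas.integrable_const_bound[where B=2]) auto
  have "(\<integral>y'. norm (y - y') \<partial>sphere_meas) \<le> (\<integral>y'. (2 - (y' \<bullet> y)) / sqrt 2 \<partial>sphere_meas)"
  proof (rule integral_mono_AE[OF int])
    show "AE y' in sphere_meas. norm (y - y') \<le> (2 - (y' \<bullet> y)) / sqrt 2"
      using AE_sphere_meas
    proof eventually_elim
      case (elim y')
      then have "(norm (y - y'))\<^sup>2 = 2 - 2 * (y' \<bullet> y)"
        using assms by (simp add: power2_norm_eq_inner inner_diff_left inner_diff_right inner_commute norm_eq_1)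
      moreover have "0 \<le> (norm (y - y') - sqrt 2)\<^sup>2" by simp
      ultimately have "2 * sqrt 2 * norm (y - y') \<le> 2 * (2 - (y' \<bullet> y))"
        by (simp add: power2_diff algebra_simps)
      then show ?case by (simp add: field_simps)
    qed
  qed (simp add: integrable_sphere_meas_inner)
  also have "\<dots> = sqrt 2"
    by (simp add: integral_sphere_meas_inner_eq_0 integrable_sphere_meas_inner sphere_meas.prob_space real_div_sqrt)
  finally show "(\<integral>y'. norm (y - y') \<partial>sphere_meas) \<le> sqrt 2" .
qed

lemma integral_cap_params_cap_ind_diff_le:
  fixes y y' :: "'a::euclidean_space"
  assumes d: "DIM('a) = d + 1" "d \<ge> 1" and y: "norm y = 1" "norm y' = 1"
  shows "(\<integral>p. \<bar>cap_ind p y - cap_ind p y'\<bar> \<partial>cap_params) \<le> sqrt (2 / (pi * real d)) * norm (y - y')"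
proof -
  have b: "\<bar>cap_ind p y - cap_ind p y'\<bar> \<le> 1" for p
    by (simp add: cap_ind_def indicator_def)
  have "(\<integral>p. \<bar>cap_ind p y - cap_ind p y'\<bar> \<partial>cap_params)
      = (\<integral>x. (\<integral>t. \<bar>cap_ind (t, x) y - cap_ind (t, x) y'\<bar> \<partial>cap_heights) \<partial>sphere_meas)"
    by (rule integral_cap_params(1)) (use b in auto)
  also have "\<dots> \<le> (\<integral>x. \<bar>x \<bullet> (y - y')\<bar> \<partial>sphere_meas)"
  proof (rule Bochner_Integration.integral_mono')
    show "integrable sphere_meas (\<lambda>x. \<bar>x \<bullet> (y - y')\<bar>)"
      by (simp add: integrable_sphere_meas_inner)
  qed (use y in \<open>auto simp: integral_cap_heights_cap_ind_diff_le\<close>)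
  also have "\<dots> \<le> sqrt (2 / (pi * real d)) * norm (y - y')"
    by (rule integral_sphere_meas_abs_inner_le[OF d])
  finally show ?thesis .
qed

lemma integral_cap_area_variance_le:
  assumes d: "DIM('a::euclidean_space) = d + 1" "d \<ge> 1"
  shows "(\<integral>p. cap_area p - (cap_area p)\<^sup>2 \<partial>(cap_params :: (real \<times> 'a) measure)) \<le> 1 / sqrt (pi * real d)"
proof -
  let ?P = "cap_params :: (real \<times> 'a) measure" and ?S = "sphere_meas :: 'a measure"
  let ?F = "\<lambda>p y y'. \<bar>cap_ind p y - cap_ind p (y' :: 'a)\<bar>"
  let ?\<kappa> = "sqrt (2 / (pi * real d))"
  note fin = cap_params.finite_measure_axioms sphere_meas.finite_measure_axioms
  have F: "?F p y y' \<le> 1" for p y y'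
    by (simp add: cap_ind_def indicator_def)
  have F': "\<bar>\<integral>y'. ?F p y y' \<partial>?S\<bar> \<le> 1" for p y
  proof -
    have "integrable ?S (?F p y)"
      using integrable_cap_ind[of p] by simp
    then have "(\<integral>y'. ?F p y y' \<partial>?S) \<le> (\<integral>y'. 1 \<partial>?S)"
      by (rule integral_mono) (use F in auto)
    then show ?thesis by (simp add: sphere_meas.prob_space)
  qed
  have "2 * (\<integral>p. cap_area p - (cap_area p)\<^sup>2 \<partial>?P) = (\<integral>p. (\<integral>y. (\<integral>y'. ?F p y y' \<partial>?S) \<partial>?S) \<partial>?P)"
    unfolding integral_cap_ind_abs_diff by (rule integral_mult_right_zero[symmetric])
  \<comment> \<open>Two interchanges move the integral over caps innermost, where \<open>y\<close>
    and \<open>y'\<close> are fixed and the separation bound applies.\<close>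
  also have "\<dots> = (\<integral>y. (\<integral>p. (\<integral>y'. ?F p y y' \<partial>?S) \<partial>?P) \<partial>?S)"
    by (rule integral_swap_bounded[where B=1]) (use fin F' in auto)
  also have "\<dots> = (\<integral>y. (\<integral>y'. (\<integral>p. ?F p y y' \<partial>?P) \<partial>?S) \<partial>?S)"
    by (subst integral_swap_bounded[where B=1 and M="?P"]) (use fin F in auto)
  also have "\<dots> \<le> (\<integral>y. ?\<kappa> * sqrt 2 \<partial>?S)"
  proof (rule integral_mono_AE')
    show "AE y in ?S. (\<integral>y'. (\<integral>p. ?F p y y' \<partial>?P) \<partial>?S) \<le> ?\<kappa> * sqrt 2"
      using AE_sphere_meas
    proof eventually_elim
      case (elim y)
      then have y: "norm y = 1" by simp
      have "(\<integral>y'. (\<integral>p. ?F p y y' \<partial>?P) \<partial>?S) \<le> (\<integral>y'. ?\<kappa> * norm (y - y') \<partial>?S)"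
      proof (rule integral_mono_AE')
        show "AE y' in ?S. (\<integral>p. ?F p y y' \<partial>?P) \<le> ?\<kappa> * norm (y - y')"
          using AE_sphere_meas
          by eventually_elim (use y in \<open>intro integral_cap_params_cap_ind_diff_le d, auto\<close>)
      qed (use integral_sphere_meas_norm_diff_le(1)[OF y] in auto)
      also have "\<dots> \<le> ?\<kappa> * sqrt 2"
        using integral_sphere_meas_norm_diff_le(2)[OF y] by (simp add: mult_left_mono)
      finally show ?case .
    qed
  qed auto
  also have "\<dots> = 2 * (1 / sqrt (pi * real d))"
    by (simp add: sphere_meas.prob_space real_sqrt_divide)
  finally show ?thesis by simp
qed

theorem theorem1:
  fixes d :: nat and \<epsilon> :: real
  assumes "DIM('a::euclidean_space) = d + 1" and "d \<ge> 1"
    and "0 < \<epsilon>" and "\<epsilon> < 1"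
  shows "N_cap TYPE('a) \<epsilon> \<le> enat (nat \<lceil>(1 / \<epsilon>\<^sup>2) * (1 / (sqrt (pi * real d) - 1))\<rceil>)"
proof -
  let ?P = "cap_params :: (real \<times> 'a) measure"
  define q where "q = sqrt (pi * real d)"
  define N where "N = nat \<lceil>(1 / \<epsilon>\<^sup>2) * (1 / (q - 1))\<rceil>"
  define V where "V = (\<integral>p. cap_area p - (cap_area p)\<^sup>2 \<partial>?P)"
  \<comment> \<open>This makes \<open>q - 1\<close> positive, so the ceiling \<open>N\<close> is at
    least 1 and \<open>1 - V\<close> can be compared with \<open>V\<close>.\<close>
  have "1 * 1 < pi * real d"
    using pi_gt3 \<open>d \<ge> 1\<close> by (intro mult_less_le_imp_less) auto
  then have q: "q > 1" by (simp add: q_def)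
  have N: "(1 / \<epsilon>\<^sup>2) * (1 / (q - 1)) \<le> real N"
    by (simp add: N_def real_nat_ceiling_ge)
  have "0 < (1 / \<epsilon>\<^sup>2) * (1 / (q - 1))"
    using q \<open>0 < \<epsilon>\<close> by simp
  with N have N1: "N \<ge> 1" by (cases N) auto
  have int: "integrable ?P cap_area" "integrable ?P (\<lambda>p. (cap_area p)\<^sup>2)"
    by (rule cap_params.integrable_const_bound[where B=1]; simp add: cap_area_bounds abs_square_le_1)+
  have empty: "(\<integral>p. (cap_area p)\<^sup>2 \<partial>?P) = 1 - V"
    using int by (simp add: V_def integral_cap_area)
  have Vq: "V * q \<le> 1"
    using integral_cap_area_variance_le[OF assms(1,2)] q by (simp add: V_def q_def field_simps)
  have "V \<ge> 0"
    unfolding V_def by (rule Bochner_Integration.integral_nonneg)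
      (simp add: power2_eq_square mult_left_le cap_area_bounds)
  obtain X :: "nat \<Rightarrow> 'a" where X: "\<And>n. n < N \<Longrightarrow> X n \<in> sphere 0 1"
    and le: "(\<integral>p. (\<Sum>n<N. cap_ind p (X n) - cap_area p)\<^sup>2 \<partial>?P) \<le> real N * V"
    using greedy_points[of ?P sphere_meas cap_ind "sphere 0 1" N] AE_sphere_meas
    by (auto simp: cap_ind_bounds cap_params.finite_measure_axioms prob_space_sphere_meas
        cap_area_def[symmetric] integral_cap_ind_variance V_def)
  \<comment> \<open>The target is \<open>V / N \<le> \<epsilon>\<^sup>2 * (1 - V)\<close>. As
    \<open>V * q \<le> 1\<close> means \<open>V * (q - 1) \<le> 1 - V\<close>, it suffices that
    \<open>1 / (q - 1) \<le> \<epsilon>\<^sup>2 * N\<close>, which is how \<open>N\<close> is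
    chosen.\<close>
  have "V \<le> \<epsilon>\<^sup>2 * (1 - V) * real N"
  proof -
    have "V * (q - 1) \<le> 1 - V" using Vq by (simp add: algebra_simps)
    then have "V \<le> (1 - V) * (1 / (q - 1))" using q by (simp add: field_simps)
    also have "\<dots> = (1 - V) * (\<epsilon>\<^sup>2 * ((1 / \<epsilon>\<^sup>2) * (1 / (q - 1))))"
      using \<open>0 < \<epsilon>\<close> by simp
    also have "\<dots> \<le> (1 - V) * (\<epsilon>\<^sup>2 * real N)"
    proof -
      have "0 \<le> V * (q - 1)" using q \<open>V \<ge> 0\<close> by simp
      then have "0 \<le> 1 - V" using \<open>V * (q - 1) \<le> 1 - V\<close> by linarith
      then show ?thesis by (intro mult_left_mono N) auto
    qed
    finally show ?thesis by (simp add: mult_ac)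
  qed
  then have "real N * V \<le> (\<epsilon> * real N)\<^sup>2 * (1 - V)"
    using N1 by (simp add: power_mult_distrib power2_eq_square mult_ac)
  with le have "sqrt (\<integral>p. (\<Sum>n<N. cap_ind p (X n) - cap_area p)\<^sup>2 \<partial>?P) \<le> sqrt ((\<epsilon> * real N)\<^sup>2 * (1 - V))"
    by (intro real_sqrt_le_mono) (rule order_trans)
  also have "\<dots> = \<epsilon> * real N * sqrt (1 - V)"
    using \<open>0 < \<epsilon>\<close> by (simp add: real_sqrt_mult)
  finally have "L2cap X N \<le> \<epsilon> * L2cap_empty TYPE('a)"
    using N1 \<open>0 < \<epsilon>\<close>
    by (simp add: L2cap_eq[OF N1] L2cap_empty_eq empty divide_le_eq mult_ac)
  then have "N_cap TYPE('a) \<epsilon> \<le> enat N"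
    unfolding N_cap_def using N1 X by (intro INF_lower) auto
  then show ?thesis by (simp add: N_def q_def)
qed

end
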